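(* Let $1\le p\le\infty$, let $R>0$, and let $F:\mathbb{R}^2\to\mathbb{R}$ be in $L^p$ and supported in the disc $\mathbb{B}_R\subset\mathbb{R}^2$ of radius $R$ centered at $(0,0)$. For real $\theta$ let $$f_\theta(x)=\int_{\mathbb{R}}F(\cos(\theta)x+\sin(\theta)y,\ \cos(\theta)y-\sin(\theta)x)\,dy.$$ Let $\theta$ and $\varphi$ be real numbers with $\delta\equiv|\theta-\varphi|<\pi$. Then $$\|f_\theta-f_\varphi\|_{V^p}\le(2\sin(\delta/2))^{1/p}\cdot\min\left\{\delta^{1-1/p}\cdot\|F\|_{L^p}\cdot R^{2-1/p},\ \|F\|_{L^1}\cdot R^{1/p}\right\}.$$
   Context: For $p=\infty$, $1/p=0$. Volterra $p$-norm: for an integrable function $h$ of one variable supported in $[a,b]$, $(\mathcal{V}h)(x)=\int_a^xh(t)\,dt$ and $\|h\|_{V^p}=\|\mathcal{V}h\|_{L^p([a,b])}$. Here one may take $[a,b]=[-R,R]$, which contains the supports of $f_\theta$ and $f_\varphi$. *)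

theory Defs
  imports "HOL-Analysis.Analysis" "HOL-Probability.Essential_Supremum"
begin

text \<open>The real number \<open>1/p\<close> for \<open>1 \<le> p \<le> \<infinity>\<close>, with \<open>1/\<infinity> = 0\<close>.\<close>

definition recip_exponent :: "ennreal \<Rightarrow> real" where
  "recip_exponent p = enn2real (1 / p)"

lemma recip_exponent_infinity [simp]: "recip_exponent \<infinity> = 0"
  by (simp add: recip_exponent_def)

lemma recip_exponent_ennreal: "0 < q \<Longrightarrow> recip_exponent (ennreal q) = 1 / q"
  by (simp add: recip_exponent_def divide_ennreal flip: ennreal_1)

text \<open>The norm takes values in \<open>[0, \<infinity>]\<close>, so that an inequality between norms
  also asserts finiteness of the smaller one whenever the larger one is finite.\<close>

definition Lp_norm :: "'a measure \<Rightarrow> ennreal \<Rightarrow> ('a \<Rightarrow> real) \<Rightarrow> ennreal" where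
  "Lp_norm M p f =
     (if p = \<infinity> then esssup M (\<lambda>x. ennreal \<bar>f x\<bar>)
      else let I = (\<integral>\<^sup>+ x. ennreal (\<bar>f x\<bar> powr enn2real p) \<partial>M)
           in if I = \<infinity> then \<infinity> else ennreal (enn2real I powr recip_exponent p))"

definition Lp_space :: "'a measure \<Rightarrow> ennreal \<Rightarrow> ('a \<Rightarrow> real) set" where
  "Lp_space M p = {f \<in> borel_measurable M. Lp_norm M p f < \<infinity>}"

definition volterra :: "real \<Rightarrow> (real \<Rightarrow> real) \<Rightarrow> real \<Rightarrow> real" where
  "volterra a h x = (LINT t:{a..x}|lebesgue. h t)"

definition volterra_norm :: "ennreal \<Rightarrow> real \<Rightarrow> real \<Rightarrow> (real \<Rightarrow> real) \<Rightarrow> ennreal" where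
  "volterra_norm p a b h = Lp_norm (lebesgue_on {a..b}) p (volterra a h)"

text \<open>The projection \<open>f\<^sub>\<theta>\<close> of \<open>F\<close>. For Lebesgue integrable \<open>F\<close> the line integral exists for
  almost every \<open>x\<close>; at the remaining \<open>x\<close> the Bochner integral is \<open>0\<close> by convention.\<close>

definition projection :: "(real \<times> real \<Rightarrow> real) \<Rightarrow> real \<Rightarrow> real \<Rightarrow> real" where
  "projection F \<theta> x =
     (LINT y|lebesgue. F (cos \<theta> * x + sin \<theta> * y, cos \<theta> * y - sin \<theta> * x))"

end

theory Submission
  imports Defs "HOL-Real_Asymp.Real_Asymp"
begin

text \<open>
  Write \<open>coord \<theta> z = cos \<theta> * fst z - sin \<theta> * snd z\<close> for the coordinate of \<open>z\<close> along the axis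
  onto which \<open>projection F \<theta>\<close> projects. Integrating the projection up to \<open>x\<close> means, after the
  rotation \<open>rot \<theta>\<close>, integrating \<open>F\<close> over the half-plane \<open>coord \<theta> z \<le> x\<close>
  (\<open>integral_projection\<close>). Hence the Volterra transform of the difference of two projections,
  at \<open>x\<close>, is the integral of \<open>F\<close> against a function with values in \<open>{-1, 0, 1}\<close>, and it is
  bounded by the integral of \<open>\<bar>F\<bar>\<close> over the set \<open>W\<^sub>x = halfplane_diff \<theta> \<phi> x\<close> of the points that
  lie in exactly one of the two half-planes. Everything follows from the sizes of the two kinds
  of sections of the relation \<open>z \<in> W\<^sub>x\<close>, where \<open>z\<close> is in the disc:

  \<^item> For fixed \<open>z\<close> the offsets \<open>x\<close> with \<open>z \<in> W\<^sub>x\<close> form an interval between \<open>coord \<theta> z\<close> and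
    \<open>coord \<phi> z\<close>. Its length is at most the distance \<open>2 sin (\<delta> / 2)\<close> of two unit vectors at
    angle \<open>\<delta>\<close>, times \<open>R\<close> (\<open>emeasure_halfplane_diff_offsets_le\<close>).

  \<^item> For fixed \<open>x\<close> the part of \<open>W\<^sub>x\<close> in the disc has area at most \<open>\<delta> R\<^sup>2\<close>
    (\<open>emeasure_halfplane_diff_le\<close>). In polar coordinates this is clear: turning an arc of a circle
    of radius \<open>r\<close> by \<open>\<delta>\<close> changes it on a set of length at most \<open>2 \<delta> r\<close>. The proof below
    needs only Cartesian coordinates: \<open>W\<^sub>x\<close> is a double wedge whose slices parallel to the
    bisector of the two axes are explicit intervals, which gives the area bound \<open>2 R\<^sup>2 tan (\<delta> / 2)\<close>;
    cutting the angle into \<open>n\<close> equal steps improves it to \<open>2 n R\<^sup>2 tan (\<delta> / (2 n))\<close>, whose limit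
    is \<open>\<delta> R\<^sup>2\<close>.

  For \<open>p = \<infinity>\<close> the area bound gives the first term of the minimum, and bounding the integral over
  \<open>W\<^sub>x\<close> by the whole integral gives the second. For finite \<open>p\<close> the Hoelder inequality on \<open>W\<^sub>x\<close>
  bounds the \<open>p\<close>-th power of the transform by \<open>(\<delta> R\<^sup>2)\<^bsup>p-1\<^esup>\<close> times the integral of \<open>\<bar>F\<bar>\<^bsup>p\<^esup>\<close> over
  \<open>W\<^sub>x\<close>; integrating over \<open>x\<close> and exchanging the integrals brings in the factor
  \<open>2 sin (\<delta> / 2) R\<close> (\<open>nn_integral_powr_le_Lp\<close>). The second term of the minimum comes in the same
  way from the bound of \<open>p - 1\<close> of the \<open>p\<close> factors by the \<open>L\<^sup>1\<close> norm (\<open>nn_integral_powr_le_L1\<close>).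
\<close>

section \<open>Rotations of the plane\<close>

text \<open>The argument of \<open>F\<close> in the definition of the projection: \<open>rot \<theta> (x, y)\<close> is the point with
  coordinate \<open>x\<close> along the axis of the projection and \<open>y\<close> along the line of integration.\<close>

definition rot :: "real \<Rightarrow> real \<times> real \<Rightarrow> real \<times> real" where
  "rot \<theta> z = (cos \<theta> * fst z + sin \<theta> * snd z, cos \<theta> * snd z - sin \<theta> * fst z)"

definition coord :: "real \<Rightarrow> real \<times> real \<Rightarrow> real" where
  "coord \<theta> z = cos \<theta> * fst z - sin \<theta> * snd z"

lemma rot_measurable [measurable]: "rot \<theta> \<in> borel_measurable borel"
  unfolding rot_def by (intro borel_measurable_continuous_onI continuous_intros)

lemma coord_measurable [measurable]: "coord \<theta> \<in> borel_measurable borel"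
  unfolding coord_def by (intro borel_measurable_continuous_onI continuous_intros)

lemma coord_rot: "coord \<theta> (rot \<alpha> z) = coord (\<theta> - \<alpha>) z"
  by (simp add: coord_def rot_def cos_diff sin_diff algebra_simps)

lemma coord_rot_self [simp]: "coord \<theta> (rot \<theta> z) = fst z"
  unfolding coord_rot by (simp add: coord_def)

lemma norm_rot [simp]: "norm (rot \<theta> z) = norm z"
proof -
  have "(cos \<theta> * fst z + sin \<theta> * snd z)\<^sup>2 + (cos \<theta> * snd z - sin \<theta> * fst z)\<^sup>2
        = ((cos \<theta>)\<^sup>2 + (sin \<theta>)\<^sup>2) * ((fst z)\<^sup>2 + (snd z)\<^sup>2)"
    by algebra
  then show ?thesis
    by (simp add: norm_prod_def rot_def)
qed

text \<open>The coordinate is the first component of a rotated point, and rotations preserve the norm.\<close>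

lemma abs_coord_le: "\<bar>coord \<theta> z\<bar> \<le> norm z"
proof -
  have "coord \<theta> z = fst (rot (- \<theta>) z)"
    by (simp add: coord_def rot_def)
  also have "\<bar>fst (rot (- \<theta>) z)\<bar> \<le> norm (rot (- \<theta>) z)"
    using norm_fst_le[of "fst (rot (- \<theta>) z)" "snd (rot (- \<theta>) z)"] by simp
  finally show ?thesis
    by simp
qed

lemma nn_integral_lborel_pair:
  fixes f :: "real \<times> real \<Rightarrow> ennreal"
  assumes [measurable]: "f \<in> borel_measurable borel"
  shows "integral\<^sup>N lborel f = (\<integral>\<^sup>+ x. \<integral>\<^sup>+ y. f (x, y) \<partial>lborel \<partial>lborel)"
    and "integral\<^sup>N lborel f = (\<integral>\<^sup>+ y. \<integral>\<^sup>+ x. f (x, y) \<partial>lborel \<partial>lborel)"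
proof -
  have m: "f \<in> borel_measurable (lborel \<Otimes>\<^sub>M lborel)"
    by (simp add: lborel_prod)
  show "integral\<^sup>N lborel f = (\<integral>\<^sup>+ x. \<integral>\<^sup>+ y. f (x, y) \<partial>lborel \<partial>lborel)"
    using lborel.nn_integral_fst[OF m] by (simp add: lborel_prod)
  then show "integral\<^sup>N lborel f = (\<integral>\<^sup>+ y. \<integral>\<^sup>+ x. f (x, y) \<partial>lborel \<partial>lborel)"
    using lborel_pair.Fubini'[of "\<lambda>x y. f (x, y)"] m by (simp add: case_prod_eta)
qed

text \<open>If \<open>cos \<theta> \<noteq> 0\<close>, the substitution \<open>u = cos \<theta> x + sin \<theta> y\<close> for fixed \<open>y\<close>, followed by a
  substitution in \<open>y\<close> for fixed \<open>u\<close>, carries the rotated integral to the original one with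
  Jacobian factors \<open>1 / \<bar>cos \<theta>\<bar>\<close> and \<open>\<bar>cos \<theta>\<bar>\<close>. Otherwise the rotation exchanges the axes
  up to signs.\<close>

lemma nn_integral_rot:
  fixes f :: "real \<times> real \<Rightarrow> ennreal"
  assumes [measurable]: "f \<in> borel_measurable borel"
  shows "(\<integral>\<^sup>+ z. f (rot \<theta> z) \<partial>lborel) = integral\<^sup>N lborel f"
proof -
  define c s where "c = cos \<theta>" and "s = sin \<theta>"
  have cs: "c * c + s * s = 1"
    unfolding c_def s_def by (metis power2_eq_square sin_cos_squared_add2)
  have rot: "rot \<theta> (x, y) = (c * x + s * y, c * y - s * x)" for x y
    by (simp add: rot_def c_def s_def)
  show ?thesis
  proof (cases "c = 0")
    case True
    have s: "s \<noteq> 0" "\<bar>s\<bar> = 1" using cs True by (auto simp: square_eq_1_iff)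
    have "(\<integral>\<^sup>+ z. f (rot \<theta> z) \<partial>lborel) = (\<integral>\<^sup>+ y. \<integral>\<^sup>+ x. f (s * y, - s * x) \<partial>lborel \<partial>lborel)"
      by (subst nn_integral_lborel_pair(2)) (simp_all add: rot True)
    also have "\<dots> = (\<integral>\<^sup>+ y. \<integral>\<^sup>+ x. f (s * y, x) \<partial>lborel \<partial>lborel)"
    proof (rule nn_integral_cong)
      fix y :: real
      show "(\<integral>\<^sup>+ x. f (s * y, - s * x) \<partial>lborel) = (\<integral>\<^sup>+ x. f (s * y, x) \<partial>lborel)"
        using nn_integral_real_affine[of "\<lambda>x. f (s * y, x)" "- s" 0] s by simp
    qed
    also have "\<dots> = (\<integral>\<^sup>+ y. \<integral>\<^sup>+ x. f (y, x) \<partial>lborel \<partial>lborel)"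
      using nn_integral_real_affine[of "\<lambda>y. \<integral>\<^sup>+ x. f (y, x) \<partial>lborel" s 0] s by simp
    also have "\<dots> = integral\<^sup>N lborel f"
      by (simp add: nn_integral_lborel_pair(1))
    finally show ?thesis .
  next
    case False
    have subst: "c * (u / c - s * y / c) + s * y = u"
      "c * y - s * (u / c - s * y / c) = (y - s * u) / c" for u y
    proof -
      have "c * y - s * (u / c - s * y / c) = ((c * c + s * s) * y - s * u) / c"
        using False by (simp add: field_simps)
      then show "c * y - s * (u / c - s * y / c) = (y - s * u) / c"
        by (simp add: cs)
    qed (use False in \<open>simp add: field_simps\<close>)
    have "(\<integral>\<^sup>+ z. f (rot \<theta> z) \<partial>lborel)
        = (\<integral>\<^sup>+ y. \<integral>\<^sup>+ x. f (c * x + s * y, c * y - s * x) \<partial>lborel \<partial>lborel)"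
      by (subst nn_integral_lborel_pair(2)) (simp_all add: rot)
    also have "\<dots> = (\<integral>\<^sup>+ y. ennreal \<bar>1/c\<bar> * (\<integral>\<^sup>+ u. f (u, (y - s * u) / c) \<partial>lborel) \<partial>lborel)"
    proof (intro nn_integral_cong)
      fix y :: real
      show "(\<integral>\<^sup>+ x. f (c * x + s * y, c * y - s * x) \<partial>lborel)
          = ennreal \<bar>1/c\<bar> * (\<integral>\<^sup>+ u. f (u, (y - s * u) / c) \<partial>lborel)"
        using nn_integral_real_affine[of "\<lambda>x. f (c * x + s * y, c * y - s * x)" "1 / c" "- (s * y) / c"] False
        by (simp add: subst)
    qed
    also have "\<dots> = ennreal \<bar>1/c\<bar> * (\<integral>\<^sup>+ y. \<integral>\<^sup>+ u. f (u, (y - s * u) / c) \<partial>lborel \<partial>lborel)"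
      by (subst nn_integral_cmult) auto
    also have "\<dots> = ennreal \<bar>1/c\<bar> * (\<integral>\<^sup>+ u. \<integral>\<^sup>+ y. f (u, (y - s * u) / c) \<partial>lborel \<partial>lborel)"
      by (subst lborel_pair.Fubini') auto
    also have "\<dots> = ennreal \<bar>1/c\<bar> * (\<integral>\<^sup>+ u. ennreal \<bar>c\<bar> * (\<integral>\<^sup>+ v. f (u, v) \<partial>lborel) \<partial>lborel)"
    proof (intro arg_cong2[where f="(*)"] nn_integral_cong refl)
      fix u :: real
      show "(\<integral>\<^sup>+ y. f (u, (y - s * u) / c) \<partial>lborel) = ennreal \<bar>c\<bar> * (\<integral>\<^sup>+ v. f (u, v) \<partial>lborel)"
        using nn_integral_real_affine[of "\<lambda>y. f (u, (y - s * u) / c)" c "s * u"] False by simp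
    qed
    also have "\<dots> = ennreal \<bar>1/c\<bar> * ennreal \<bar>c\<bar> * (\<integral>\<^sup>+ u. \<integral>\<^sup>+ v. f (u, v) \<partial>lborel \<partial>lborel)"
      by (subst nn_integral_cmult) (auto simp: mult.assoc)
    also have "ennreal \<bar>1/c\<bar> * ennreal \<bar>c\<bar> = 1"
      using False by (simp flip: ennreal_mult)
    finally show ?thesis
      by (simp add: nn_integral_lborel_pair(1))
  qed
qed

lemma distr_rot: "distr lborel borel (rot \<theta>) = lborel"
proof (rule measure_eqI)
  fix A :: "(real \<times> real) set"
  assume "A \<in> sets (distr lborel borel (rot \<theta>))"
  then have A [measurable]: "A \<in> sets borel" by simp
  have "emeasure (distr lborel borel (rot \<theta>)) A = (\<integral>\<^sup>+ z. indicator A (rot \<theta> z) \<partial>lborel)"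
    by (subst nn_integral_indicator[symmetric], simp, subst nn_integral_distr) simp_all
  also have "\<dots> = emeasure lborel A"
    by (subst nn_integral_rot) simp_all
  finally show "emeasure (distr lborel borel (rot \<theta>)) A = emeasure lborel A" .
qed simp

section \<open>The region between two half-planes\<close>

definition halfplane_diff :: "real \<Rightarrow> real \<Rightarrow> real \<Rightarrow> (real \<times> real) set" where
  "halfplane_diff \<theta> \<phi> x = {z. (coord \<theta> z \<le> x) \<noteq> (coord \<phi> z \<le> x)}"

lemma halfplane_diff_measurable [measurable, simp]: "halfplane_diff \<theta> \<phi> x \<in> sets borel"
  unfolding halfplane_diff_def by measurable

lemma halfplane_diff_disc_borel [simp]: "halfplane_diff \<theta> \<phi> x \<inter> cball 0 R \<in> sets borel"
  by (intro sets.Int halfplane_diff_measurable borel_closed closed_cball)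

text \<open>The sum-to-product formulas turn the difference of the two coordinates into
  \<open>- 2 sin ((\<theta> - \<phi>) / 2)\<close> times the coordinate in a third direction, perpendicular to the
  bisector.\<close>

lemma abs_coord_diff_le:
  assumes "\<bar>\<theta> - \<phi>\<bar> \<le> 2 * pi"
  shows "\<bar>coord \<theta> z - coord \<phi> z\<bar> \<le> 2 * sin (\<bar>\<theta> - \<phi>\<bar> / 2) * norm z"
proof -
  define \<sigma> h where "\<sigma> = (\<theta> + \<phi>) / 2" and "h = (\<theta> - \<phi>) / 2"
  have ang: "\<theta> = \<sigma> + h" "\<phi> = \<sigma> - h"
    by (simp_all add: \<sigma>_def h_def field_simps)
  have "coord \<theta> z - coord \<phi> z = - 2 * sin h * coord (\<sigma> - pi / 2) z"
    by (simp add: coord_def ang cos_add sin_add cos_diff sin_diff algebra_simps)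
  then have "\<bar>coord \<theta> z - coord \<phi> z\<bar> = 2 * \<bar>sin h\<bar> * \<bar>coord (\<sigma> - pi / 2) z\<bar>"
    by (simp add: abs_mult)
  also have "\<dots> \<le> 2 * \<bar>sin h\<bar> * norm z"
    by (intro mult_left_mono abs_coord_le) simp
  also have "\<bar>sin h\<bar> = sin \<bar>h\<bar>"
  proof -
    have "0 \<le> sin \<bar>h\<bar>"
      using assms by (intro sin_ge_zero) (auto simp: h_def)
    then show ?thesis by (auto simp: abs_if split: if_splits)
  qed
  finally show ?thesis
    by (simp add: h_def)
qed

lemma emeasure_halfplane_diff_offsets_le:
  assumes "\<bar>\<theta> - \<phi>\<bar> \<le> 2 * pi" and "norm z \<le> R"
  shows "emeasure lborel {x. z \<in> halfplane_diff \<theta> \<phi> x} \<le> ennreal (2 * sin (\<bar>\<theta> - \<phi>\<bar> / 2) * R)"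
proof -
  have s: "0 \<le> sin (\<bar>\<theta> - \<phi>\<bar> / 2)"
    using assms(1) by (intro sin_ge_zero) auto
  have "{x. z \<in> halfplane_diff \<theta> \<phi> x} \<subseteq> {min (coord \<theta> z) (coord \<phi> z) .. max (coord \<theta> z) (coord \<phi> z)}"
    by (auto simp: halfplane_diff_def)
  then have "emeasure lborel {x. z \<in> halfplane_diff \<theta> \<phi> x}
      \<le> emeasure lborel {min (coord \<theta> z) (coord \<phi> z) .. max (coord \<theta> z) (coord \<phi> z)}"
    by (rule emeasure_mono) simp
  also have "\<dots> = ennreal \<bar>coord \<theta> z - coord \<phi> z\<bar>"
    by (simp add: min_def max_def)
  also have "\<dots> \<le> ennreal (2 * sin (\<bar>\<theta> - \<phi>\<bar> / 2) * R)"
    using abs_coord_diff_le[OF assms(1), of z] mult_left_mono[OF assms(2), of "2 * sin (\<bar>\<theta> - \<phi>\<bar> / 2)"] s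
    by (intro ennreal_leI) simp
  finally show ?thesis .
qed

text \<open>The area of the double wedge is an integral of widths that are proportional to \<open>\<bar>y\<bar>\<close>.\<close>

lemma nn_integral_abs_symmetric_interval:
  assumes "0 \<le> R"
  shows "(\<integral>\<^sup>+ y. ennreal \<bar>y\<bar> * indicator {-R..R} y \<partial>lborel) = ennreal (R\<^sup>2)"
proof -
  have deriv: "((\<lambda>y. y * \<bar>y\<bar> / 2) has_real_derivative \<bar>y\<bar>) (at y)" for y :: real
  proof (cases "y = 0")
    case True
    have "(\<lambda>h. \<bar>h\<bar> / 2) \<midarrow>0\<rightarrow> \<bar>0 :: real\<bar>"
      by (rule tendsto_eq_intros refl | simp)+
    then show ?thesis
      unfolding True has_field_derivative_iff
      by (rule Lim_transform_eventually) (auto simp: eventually_at_filter) 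
  next
    case False
    have "((\<lambda>x. sgn y * (x * x) / 2) has_real_derivative \<bar>y\<bar>) (at y)"
      by (auto intro!: derivative_eq_intros simp: sgn_real_def)
    then show ?thesis
      by (rule has_field_derivative_transform_within_open[where S = "if y > 0 then {0<..} else {..<0}"])
         (use False in \<open>auto simp: sgn_real_def\<close>)
  qed
  have "(\<integral>\<^sup>+ y. ennreal \<bar>y\<bar> * indicator {-R..R} y \<partial>lborel) = R * \<bar>R\<bar> / 2 - (- R) * \<bar>- R\<bar> / 2"
    using assms by (intro nn_integral_FTC_Icc deriv) auto
  then show ?thesis
    using assms by (simp add: power2_eq_square)
qed

text \<open>The bisector of the two directions is the first axis here. A point \<open>(u, y)\<close> lies between the two
  boundary lines only if \<open>\<bar>cos h * u - x\<bar> \<le> \<bar>sin h * y\<bar>\<close>, so the slice at height \<open>y\<close> is contained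
  in an interval of length \<open>2 tan \<bar>h\<bar> * \<bar>y\<bar>\<close>. The disc enters only through \<open>\<bar>y\<bar> \<le> R\<close>.\<close>

lemma emeasure_double_wedge_le:
  assumes "\<bar>h\<bar> < pi / 2" and "0 \<le> R"
  shows "emeasure lborel (halfplane_diff h (- h) x \<inter> cball 0 R) \<le> ennreal (2 * R\<^sup>2 * tan \<bar>h\<bar>)"
proof -
  define c s where "c = cos h" and "s = \<bar>sin h\<bar>"
  have c: "c > 0" unfolding c_def using assms(1) by (intro cos_gt_zero_pi) auto
  have t: "s / c = tan \<bar>h\<bar>" "0 \<le> s"
    using assms(1) sin_ge_zero[of "\<bar>h\<bar>"] unfolding c_def s_def tan_def
    by (cases "h \<ge> 0"; auto)+
  let ?D = "halfplane_diff h (- h) x \<inter> cball 0 R"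
  have sub: "(u, y) \<in> ?D \<Longrightarrow> y \<in> {-R..R} \<and> u \<in> {(x - s * \<bar>y\<bar>) / c .. (x + s * \<bar>y\<bar>) / c}" for u y
  proof -
    assume uy: "(u, y) \<in> ?D"
    have "\<bar>y\<bar> \<le> norm (u, y)" using norm_snd_le[of y u] by simp
    moreover have "\<bar>c * u - x\<bar> \<le> \<bar>sin h * y\<bar>"
      using uy by (auto simp: halfplane_diff_def coord_def c_def)
    then have "\<bar>c * u - x\<bar> \<le> s * \<bar>y\<bar>" by (simp add: s_def abs_mult)
    ultimately show ?thesis
      using uy c by (auto simp: field_simps abs_le_iff)
  qed
  have "emeasure lborel ?D = (\<integral>\<^sup>+ y. \<integral>\<^sup>+ u. indicator ?D (u, y) \<partial>lborel \<partial>lborel)"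
    by (subst nn_integral_lborel_pair(2)[symmetric], rule borel_measurable_indicator) simp_all
  also have "\<dots> \<le> (\<integral>\<^sup>+ y. ennreal (2 * (s / c)) * (ennreal \<bar>y\<bar> * indicator {-R..R} y) \<partial>lborel)"
  proof (intro nn_integral_mono)
    fix y :: real
    have "(\<integral>\<^sup>+ u. indicator ?D (u, y) \<partial>lborel)
        \<le> (\<integral>\<^sup>+ u. indicator {-R..R} y * indicator {(x - s * \<bar>y\<bar>) / c .. (x + s * \<bar>y\<bar>) / c} u \<partial>lborel)"
    proof (rule nn_integral_mono)
      fix u :: real
      show "indicator ?D (u, y)
          \<le> (indicator {-R..R} y * indicator {(x - s * \<bar>y\<bar>) / c .. (x + s * \<bar>y\<bar>) / c} u :: ennreal)"
        using sub[of u y] by (cases "(u, y) \<in> ?D") simp_all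
    qed
    also have "\<dots> = indicator {-R..R} y * ennreal ((x + s * \<bar>y\<bar>) / c - (x - s * \<bar>y\<bar>) / c)"
      using c t by (subst nn_integral_cmult_indicator) (auto simp: divide_right_mono emeasure_lborel_Icc)
    also have "(x + s * \<bar>y\<bar>) / c - (x - s * \<bar>y\<bar>) / c = 2 * (s / c) * \<bar>y\<bar>"
      by (simp add: diff_divide_distrib[symmetric])
    also have "ennreal (2 * (s / c) * \<bar>y\<bar>) = ennreal (2 * (s / c)) * ennreal \<bar>y\<bar>"
      using c t(2) by (intro ennreal_mult) simp_all
    finally show "(\<integral>\<^sup>+ u. indicator ?D (u, y) \<partial>lborel)
        \<le> ennreal (2 * (s / c)) * (ennreal \<bar>y\<bar> * indicator {-R..R} y)"
      by (simp only: mult_ac)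
  qed
  also have "\<dots> = ennreal (2 * (s / c)) * ennreal (R\<^sup>2)"
    using assms by (subst nn_integral_cmult) (auto simp: nn_integral_abs_symmetric_interval)
  also have "\<dots> = ennreal (2 * R\<^sup>2 * tan \<bar>h\<bar>)"
    using c t by (simp add: t(1)[symmetric] mult_ac flip: ennreal_mult)
  finally show ?thesis .
qed

lemma emeasure_halfplane_diff_le_tan:
  assumes "\<bar>\<theta> - \<phi>\<bar> < pi" and "0 \<le> R"
  shows "emeasure lborel (halfplane_diff \<theta> \<phi> x \<inter> cball 0 R) \<le> ennreal (2 * R\<^sup>2 * tan (\<bar>\<theta> - \<phi>\<bar> / 2))"
proof -
  define m h where "m = (\<theta> + \<phi>) / 2" and "h = (\<theta> - \<phi>) / 2"
  have ang: "\<theta> - m = h" "\<phi> - m = - h"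
    by (simp_all add: m_def h_def field_simps)
  have "emeasure lborel (halfplane_diff \<theta> \<phi> x \<inter> cball 0 R)
      = (\<integral>\<^sup>+ z. indicator (halfplane_diff \<theta> \<phi> x \<inter> cball 0 R) (rot m z) \<partial>lborel)"
    using nn_integral_rot[OF borel_measurable_indicator[OF halfplane_diff_disc_borel], of \<theta> \<phi> x R m] by simp
  also have "\<dots> = (\<integral>\<^sup>+ z. indicator (halfplane_diff h (- h) x \<inter> cball 0 R) z \<partial>lborel)"
    by (intro nn_integral_cong) (simp add: indicator_def halfplane_diff_def coord_rot ang)
  also have "\<dots> \<le> ennreal (2 * R\<^sup>2 * tan \<bar>h\<bar>)"
    using emeasure_double_wedge_le[of h R x] assms by (simp add: h_def)
  finally show ?thesis
    by (simp add: h_def)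
qed

text \<open>The bound \<open>2 R\<^sup>2 tan (\<delta> / 2)\<close> is sharp to first order as \<open>\<delta>\<close> tends to \<open>0\<close>, and the
  symmetric difference is subadditive along a chain of angles. So the interval of angles is
  divided into \<open>n\<close> equal parts, and \<open>n\<close> tends to infinity.\<close>

lemma emeasure_halfplane_diff_le:
  assumes "\<bar>\<theta> - \<phi>\<bar> < pi" and "0 \<le> R"
  shows "emeasure lborel (halfplane_diff \<theta> \<phi> x \<inter> cball 0 R) \<le> ennreal (\<bar>\<theta> - \<phi>\<bar> * R\<^sup>2)"
proof -
  define d where "d = \<bar>\<theta> - \<phi>\<bar>"
  \<comment> \<open>The chain of intermediate angles from \<open>\<theta>\<close> to \<open>\<phi>\<close> in \<open>n\<close> steps.\<close>
  define \<alpha> where "\<alpha> n k = \<theta> + (\<phi> - \<theta>) * (real k / real n)" for n k :: nat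
  let ?W = "\<lambda>a b. halfplane_diff a b x \<inter> cball 0 R"
  have bound: "emeasure lborel (?W \<theta> \<phi>) \<le> ennreal (real n * (2 * R\<^sup>2 * tan (d / real n / 2)))"
    if n: "n > 0" for n :: nat
  proof -
    have step: "\<bar>\<alpha> n k - \<alpha> n (Suc k)\<bar> = d / real n" for k
    proof -
      have "\<alpha> n k - \<alpha> n (Suc k) = (\<theta> - \<phi>) / real n"
        by (simp add: \<alpha>_def add_divide_distrib diff_divide_distrib algebra_simps)
      then show ?thesis by (simp add: d_def)
    qed
    have dn: "d / real n < pi"
    proof -
      have "d / real n \<le> d" using n by (simp add: d_def divide_le_eq mult_le_cancel_left1)
      then show ?thesis using assms by (simp add: d_def)
    qed
    have tan: "0 \<le> 2 * R\<^sup>2 * tan (d / real n / 2)"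
      using dn by (intro mult_nonneg_nonneg tan_pos_pi2_le) (auto simp: d_def)
    have "?W (\<alpha> n 0) (\<alpha> n j) \<subseteq> (\<Union>k<j. ?W (\<alpha> n k) (\<alpha> n (Suc k)))" for j
      by (induction j) (auto simp: halfplane_diff_def lessThan_Suc)
    from this[of n] have "?W \<theta> \<phi> \<subseteq> (\<Union>k<n. ?W (\<alpha> n k) (\<alpha> n (Suc k)))"
      using n by (simp add: \<alpha>_def)
    then have "emeasure lborel (?W \<theta> \<phi>) \<le> emeasure lborel (\<Union>k<n. ?W (\<alpha> n k) (\<alpha> n (Suc k)))"
      by (rule emeasure_mono) auto
    also have "\<dots> \<le> (\<Sum>k<n. emeasure lborel (?W (\<alpha> n k) (\<alpha> n (Suc k))))"
      by (rule emeasure_subadditive_finite) auto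
    also have "\<dots> \<le> (\<Sum>k<n. ennreal (2 * R\<^sup>2 * tan (d / real n / 2)))"
    proof (rule sum_mono)
      fix k
      show "emeasure lborel (?W (\<alpha> n k) (\<alpha> n (Suc k))) \<le> ennreal (2 * R\<^sup>2 * tan (d / real n / 2))"
        using emeasure_halfplane_diff_le_tan[of "\<alpha> n k" "\<alpha> n (Suc k)" R x] dn assms(2)
        by (simp only: step)
    qed
    also have "\<dots> = ennreal (real n * (2 * R\<^sup>2 * tan (d / real n / 2)))"
      using tan by (simp add: ennreal_mult ennreal_of_nat_eq_real_of_nat)
    finally show ?thesis .
  qed
  have "(\<lambda>n. real n * (2 * R\<^sup>2 * tan (d / real n / 2))) \<longlonglongrightarrow> d * R\<^sup>2"
    by real_asymp
  then have "(\<lambda>n. ennreal (real n * (2 * R\<^sup>2 * tan (d / real n / 2)))) \<longlonglongrightarrow> ennreal (d * R\<^sup>2)"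
    by (rule tendsto_ennrealI)
  then show ?thesis
    unfolding d_def[symmetric]
    by (rule LIMSEQ_le_const) (use bound in \<open>auto intro!: exI[of _ 1]\<close>)
qed

section \<open>The Volterra transform of a projection\<close>

lemma integrable_rot:
  fixes f :: "real \<times> real \<Rightarrow> real"
  assumes "integrable lborel f"
  shows "integrable lborel (\<lambda>z. f (rot \<theta> z))" and "(\<integral>z. f (rot \<theta> z) \<partial>lborel) = integral\<^sup>L lborel f"
proof -
  have f: "f \<in> borel_measurable borel"
    using borel_measurable_integrable[OF assms] by simp
  show "integrable lborel (\<lambda>z. f (rot \<theta> z))"
    using assms f integrable_distr_eq[of "rot \<theta>" lborel borel f] by (simp add: distr_rot)
  show "(\<integral>z. f (rot \<theta> z) \<partial>lborel) = integral\<^sup>L lborel f"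
    using f integral_distr[of "rot \<theta>" lborel borel f] by (simp add: distr_rot)
qed

lemma AE_rot:
  assumes "AE z in lborel. P z"
  shows "AE z in lborel. P (rot \<theta> z)"
proof -
  have "AE z in distr lborel borel (rot \<theta>). P z"
    using assms unfolding distr_rot .
  then show ?thesis
    by (rule AE_distrD[rotated]) simp
qed

lemma projection_alt: "projection F \<theta> x = (LINT y|lebesgue. F (rot \<theta> (x, y)))"
  by (simp add: projection_def rot_def)

lemma projection_borel:
  assumes [measurable]: "f \<in> borel_measurable borel"
  shows "projection f \<theta> x = (LINT y|lborel. f (rot \<theta> (x, y)))"
  unfolding projection_alt by (rule integral_completion) simp

text \<open>By rotation invariance and the Fubini theorem a null set of the plane meets almost every line of
  integration in a null set. This reduces the theorem, which is about Lebesgue measurable functions,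
  to Borel functions, whose restrictions to all lines are measurable.\<close>

lemma projection_cong_AE:
  assumes f [measurable]: "f \<in> borel_measurable borel" and F: "AE z in lborel. F z = f z"
  shows "AE x in lborel. projection F \<theta> x = projection f \<theta> x"
proof -
  have "AE z in lborel \<Otimes>\<^sub>M lborel. F (rot \<theta> z) = f (rot \<theta> z)"
    using AE_rot[OF F] unfolding lborel_prod .
  then have "AE x in lborel. AE y in lborel. F (rot \<theta> (x, y)) = f (rot \<theta> (x, y))"
    by (rule lborel_pair.AE_pair)
  then show ?thesis
  proof eventually_elim
    case (elim x)
    have m: "(\<lambda>y. f (rot \<theta> (x, y))) \<in> borel_measurable lebesgue"
      by (rule measurable_completion) simp
    have ae: "AE y in lebesgue. f (rot \<theta> (x, y)) = F (rot \<theta> (x, y))"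
      using AE_completion[OF elim] by eventually_elim simp
    show ?case
      unfolding projection_alt
      by (rule integral_cong_AE[OF borel_measurable_AE[OF m ae] m])
         (use ae in \<open>eventually_elim, simp\<close>)
  qed
qed

lemma volterra_cong_AE:
  assumes [measurable]: "h \<in> borel_measurable borel" and ae: "AE x in lborel. g x = h x"
  shows "volterra a g x = (\<integral>t. indicator {a..x} t * h t \<partial>lborel)"
proof -
  have m: "(\<lambda>t. indicator {a..x} t * h t) \<in> borel_measurable lborel"
    by simp
  have ae': "AE t in lebesgue. indicator {a..x} t * h t = indicator {a..x} t * g t"
    using AE_completion[OF ae] by eventually_elim simp
  have "volterra a g x = (LINT t|lebesgue. indicator {a..x} t * g t)"
    by (simp add: volterra_def set_lebesgue_integral_def)
  also have "\<dots> = (LINT t|lebesgue. indicator {a..x} t * h t)"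
    by (rule integral_cong_AE[OF borel_measurable_AE[OF measurable_completion[OF m] ae'] measurable_completion[OF m]])
       (use ae' in \<open>eventually_elim, auto\<close>)
  also have "\<dots> = (LINT t|lborel. indicator {a..x} t * h t)"
    by (rule integral_completion[OF m])
  finally show ?thesis .
qed

text \<open>The Fubini theorem in the rotated coordinates: \<open>t = coord \<theta> z\<close> for \<open>z = rot \<theta> (t, y)\<close>, so
  the condition \<open>t \<le> x\<close> is a half-plane. The points that the lower limit \<open>-R\<close> cuts off have
  \<open>norm z > R\<close>, since \<open>norm z \<ge> \<bar>t\<bar>\<close>.\<close>

lemma integral_projection:
  assumes f: "integrable lborel f" and supp: "\<And>z. norm z > R \<Longrightarrow> f z = 0"
  shows "integrable lborel (\<lambda>t. indicator {-R..x} t * projection f \<theta> t)"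
    and "(\<integral>t. indicator {-R..x} t * projection f \<theta> t \<partial>lborel)
         = (\<integral>z. indicator {z. coord \<theta> z \<le> x} z * f z \<partial>lborel)"
proof -
  have [measurable]: "f \<in> borel_measurable borel"
    using borel_measurable_integrable[OF f] by simp
  define g where "g z = indicator {z. coord \<theta> z \<le> x} z * f z" for z
  have "integrable lborel g"
    unfolding g_def using integrable_mult_indicator[OF _ f, of "{z. coord \<theta> z \<le> x}"] by simp
  note g = this integrable_rot[OF this, of \<theta>]
  have "g (rot \<theta> (t, y)) = indicator {-R..x} t * f (rot \<theta> (t, y))" for t y
  proof (cases "t < - R")
    case True
    then have "norm (rot \<theta> (t, y)) > R"
      using norm_fst_le[of t y] by simp
    then show ?thesis using supp by (simp add: g_def)
  qed (auto simp: g_def indicator_def)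
  then have eq: "(\<integral>y. g (rot \<theta> (t, y)) \<partial>lborel) = indicator {-R..x} t * projection f \<theta> t" for t
    by (simp add: projection_borel)
  have int: "integrable (lborel \<Otimes>\<^sub>M lborel) (\<lambda>z. g (rot \<theta> z))"
    using g by (simp add: lborel_prod)
  show "integrable lborel (\<lambda>t. indicator {-R..x} t * projection f \<theta> t)"
    using lborel_pair.integrable_fst'[OF int] by (simp add: eq)
  have "(\<integral>t. indicator {-R..x} t * projection f \<theta> t \<partial>lborel) = (\<integral>z. g (rot \<theta> z) \<partial>lborel)"
    using lborel_pair.integral_fst'[OF int] by (simp add: eq lborel_prod)
  also have "\<dots> = (\<integral>z. g z \<partial>lborel)"
    by (rule g)
  finally show "(\<integral>t. indicator {-R..x} t * projection f \<theta> t \<partial>lborel)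
         = (\<integral>z. indicator {z. coord \<theta> z \<le> x} z * f z \<partial>lborel)"
    by (simp only: g_def)
qed

lemma volterra_projection_diff:
  assumes f: "integrable lborel f" and supp: "\<And>z. norm z > R \<Longrightarrow> f z = 0"
    and F: "AE z in lborel. F z = f z"
  shows "volterra (- R) (\<lambda>x. projection F \<theta> x - projection F \<phi> x) x
    = (\<integral>z. (indicator {z. coord \<theta> z \<le> x} z - indicator {z. coord \<phi> z \<le> x} z) * f z \<partial>lborel)"
proof -
  have [measurable]: "f \<in> borel_measurable borel"
    using borel_measurable_integrable[OF f] by simp
  have [measurable]: "projection f \<alpha> \<in> borel_measurable borel" for \<alpha>
  proof -
    have "(\<lambda>x. LINT y|lborel. f (rot \<alpha> (x, y))) \<in> borel_measurable lborel"
      by (rule lborel.borel_measurable_lebesgue_integral) simp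
    moreover have "projection f \<alpha> = (\<lambda>x. LINT y|lborel. f (rot \<alpha> (x, y)))"
      by (rule ext) (simp add: projection_borel)
    ultimately show ?thesis by simp
  qed
  have ind: "integrable lborel (\<lambda>z. indicator {z. coord \<alpha> z \<le> x} z * f z)" for \<alpha>
    using integrable_mult_indicator[OF _ f, of "{z. coord \<alpha> z \<le> x}"] by simp
  have "AE x in lborel. projection F \<theta> x - projection F \<phi> x = projection f \<theta> x - projection f \<phi> x"
    using projection_cong_AE[OF _ F, of \<theta>] projection_cong_AE[OF _ F, of \<phi>] by auto
  then have "volterra (- R) (\<lambda>x. projection F \<theta> x - projection F \<phi> x) x
      = (\<integral>t. indicator {-R..x} t * (projection f \<theta> t - projection f \<phi> t) \<partial>lborel)"
    by (intro volterra_cong_AE) auto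
  also have "\<dots> = (\<integral>z. indicator {z. coord \<theta> z \<le> x} z * f z \<partial>lborel)
      - (\<integral>z. indicator {z. coord \<phi> z \<le> x} z * f z \<partial>lborel)"
    by (simp add: right_diff_distrib integral_projection[OF f supp])
  also have "\<dots> = (\<integral>z. (indicator {z. coord \<theta> z \<le> x} z - indicator {z. coord \<phi> z \<le> x} z) * f z \<partial>lborel)"
    using ind by (simp add: left_diff_distrib)
  finally show ?thesis .
qed

lemma abs_integral_halfplane_diff_le:
  assumes f: "integrable lborel f"
  shows "ennreal \<bar>\<integral>z. (indicator {z. coord \<theta> z \<le> x} z - indicator {z. coord \<phi> z \<le> x} z) * f z \<partial>lborel\<bar>
    \<le> (\<integral>\<^sup>+z. ennreal \<bar>f z\<bar> * indicator (halfplane_diff \<theta> \<phi> x) z \<partial>lborel)"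
proof -
  have [measurable]: "f \<in> borel_measurable borel"
    using borel_measurable_integrable[OF f] by simp
  have ind: "integrable lborel (\<lambda>z. indicator {z. coord \<alpha> z \<le> x} z * f z)" for \<alpha>
    using integrable_mult_indicator[OF _ f, of "{z. coord \<alpha> z \<le> x}"] by simp
  have "integrable lborel (\<lambda>z. (indicator {z. coord \<theta> z \<le> x} z - indicator {z. coord \<phi> z \<le> x} z) * f z)"
    using ind by (simp add: left_diff_distrib)
  from integral_norm_bound_ennreal[OF this]
  show ?thesis
    by (simp, elim order_trans, intro nn_integral_mono)
       (auto simp: halfplane_diff_def split: split_indicator)
qed

section \<open>Averaging over the sections of a set\<close>

text \<open>The graph of \<open>\<lambda>t. t powr q\<close> lies above its tangent at \<open>a\<close>; this is the Young inequality for the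
  product of \<open>t\<close> and \<open>a powr (q - 1)\<close>.\<close>

lemma Youngs_inequality_tangent:
  fixes a t q :: real
  assumes "1 \<le> q" "0 \<le> a" "0 \<le> t"
  shows "q * a powr (q - 1) * t \<le> t powr q + (q - 1) * a powr q"
proof (cases "q = 1")
  case True
  then show ?thesis using assms by simp
next
  case False
  then have q: "q > 1" using assms by simp
  have "t * a powr (q - 1) \<le> t powr q / q + (a powr (q - 1)) powr (q / (q - 1)) / (q / (q - 1))"
    using q assms by (intro Youngs_inequality) (auto simp: field_simps)
  also have "(a powr (q - 1)) powr (q / (q - 1)) = a powr q"
    using q by (simp add: powr_powr)
  finally have "q * (t * a powr (q - 1)) \<le> q * (t powr q / q + a powr q / (q / (q - 1)))"
    using q by (intro mult_left_mono) auto
  also have "\<dots> = t powr q + (q - 1) * a powr q"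
    using q by (simp add: field_simps)
  finally show ?thesis
    by (simp add: mult_ac)
qed

text \<open>The Hoelder inequality on a set of measure at most \<open>A\<close>. It follows by integrating the tangent
  inequality over \<open>W\<close> with the point of tangency \<open>r / A\<close>, which is the mean of \<open>\<bar>f\<bar>\<close> if \<open>W\<close> has
  measure exactly \<open>A\<close> and \<open>r\<close> is the integral. Only a lower bound \<open>r\<close> of the integral is
  assumed, so that the integral may be infinite.\<close>

lemma powr_nn_integral_le:
  fixes f :: "'a \<Rightarrow> real" and q A r :: real
  assumes [measurable]: "f \<in> borel_measurable M" "W \<in> sets M"
    and q: "1 \<le> q" and A: "0 < A" "emeasure M W \<le> ennreal A"
    and r: "0 \<le> r" "ennreal r \<le> (\<integral>\<^sup>+ z. ennreal \<bar>f z\<bar> * indicator W z \<partial>M)"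
  shows "ennreal (r powr q) \<le> ennreal (A powr (q - 1)) * (\<integral>\<^sup>+ z. ennreal (\<bar>f z\<bar> powr q) * indicator W z \<partial>M)"
    (is "_ \<le> _ * ?J")
proof (cases "?J = \<infinity> \<or> r = 0")
  case True
  then show ?thesis using A q by (auto simp: ennreal_mult_top)
next
  case False
  then obtain j where j: "?J = ennreal j" "0 \<le> j"
    by (cases ?J) auto
  have r0: "r > 0" using False r by simp
  define a where "a = r / A"
  have a: "a > 0" using r0 A by (simp add: a_def)
  have "ennreal (q * a powr (q - 1)) * ennreal r
      \<le> ennreal (q * a powr (q - 1)) * (\<integral>\<^sup>+ z. ennreal \<bar>f z\<bar> * indicator W z \<partial>M)"
    by (intro mult_left_mono r) simp
  also have "\<dots> = (\<integral>\<^sup>+ z. ennreal (q * a powr (q - 1) * \<bar>f z\<bar>) * indicator W z \<partial>M)"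
    using q by (subst nn_integral_cmult[symmetric]) (auto simp: ennreal_mult mult.assoc)
  also have "\<dots> \<le> (\<integral>\<^sup>+ z. ennreal (\<bar>f z\<bar> powr q) * indicator W z
      + ennreal ((q - 1) * a powr q) * indicator W z \<partial>M)"
    using q a Youngs_inequality_tangent[of q a]
    by (intro nn_integral_mono) (auto split: split_indicator intro!: ennreal_leI simp flip: ennreal_plus)
  also have "\<dots> = ?J + ennreal ((q - 1) * a powr q) * emeasure M W"
    by (subst nn_integral_add) (auto simp: nn_integral_cmult_indicator)
  also have "\<dots> \<le> ?J + ennreal ((q - 1) * a powr q) * ennreal A"
    by (intro add_left_mono mult_left_mono A) simp
  finally have "q * (a powr (q - 1) * r) \<le> j + (q - 1) * (a powr q * A)"
    using q a r A j by (simp add: mult.assoc flip: ennreal_mult ennreal_plus)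
  moreover have "a powr (q - 1) * r = r powr q / A powr (q - 1)"
    using r0 A by (simp add: a_def powr_divide powr_diff)
  moreover have "a powr q * A = r powr q / A powr (q - 1)"
    using r0 A by (simp add: a_def powr_divide powr_diff)
  ultimately have "r powr q / A powr (q - 1) \<le> j"
    by (simp add: left_diff_distrib diff_divide_distrib)
  then have "r powr q \<le> A powr (q - 1) * j"
    using A by (simp add: field_simps)
  then show ?thesis
    using j by (simp add: ennreal_leI flip: ennreal_mult)
qed

text \<open>After exchanging the integrals, \<open>g z\<close> is multiplied with the measure of the section at \<open>z\<close>.\<close>

lemma (in pair_sigma_finite) nn_integral_sections_le:
  fixes g :: "'b \<Rightarrow> ennreal" and W :: "('a \<times> 'b) set"
  assumes [measurable]: "g \<in> borel_measurable M2" "W \<in> sets (M1 \<Otimes>\<^sub>M M2)"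
    and B: "\<And>z. z \<in> space M2 \<Longrightarrow> g z \<noteq> 0 \<Longrightarrow> emeasure M1 {x \<in> space M1. (x, z) \<in> W} \<le> B"
  shows "(\<integral>\<^sup>+ x. \<integral>\<^sup>+ z. g z * indicator W (x, z) \<partial>M2 \<partial>M1) \<le> B * (\<integral>\<^sup>+ z. g z \<partial>M2)"
proof -
  have "(\<integral>\<^sup>+ x. \<integral>\<^sup>+ z. g z * indicator W (x, z) \<partial>M2 \<partial>M1)
      = (\<integral>\<^sup>+ z. \<integral>\<^sup>+ x. g z * indicator W (x, z) \<partial>M1 \<partial>M2)"
    by (rule Fubini'[symmetric]) measurable
  also have "\<dots> = (\<integral>\<^sup>+ z. g z * emeasure M1 {x \<in> space M1. (x, z) \<in> W} \<partial>M2)"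
  proof (rule nn_integral_cong)
    fix z assume z: "z \<in> space M2"
    then have [measurable]: "{x \<in> space M1. (x, z) \<in> W} \<in> sets M1"
      by measurable
    have "(\<integral>\<^sup>+ x. g z * indicator W (x, z) \<partial>M1)
        = (\<integral>\<^sup>+ x. g z * indicator {x \<in> space M1. (x, z) \<in> W} x \<partial>M1)"
      by (intro nn_integral_cong) (auto split: split_indicator)
    then show "(\<integral>\<^sup>+ x. g z * indicator W (x, z) \<partial>M1) = g z * emeasure M1 {x \<in> space M1. (x, z) \<in> W}"
      by (simp add: nn_integral_cmult_indicator)
  qed
  also have "\<dots> \<le> (\<integral>\<^sup>+ z. B * g z \<partial>M2)"
  proof (intro nn_integral_mono)
    fix z assume "z \<in> space M2"
    then show "g z * emeasure M1 {x \<in> space M1. (x, z) \<in> W} \<le> B * g z"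
      using B[of z] by (cases "g z = 0") (auto simp: mult.commute[of B] mult_left_mono)
  qed
  also have "\<dots> = B * (\<integral>\<^sup>+ z. g z \<partial>M2)"
    by (rule nn_integral_cmult) simp
  finally show ?thesis .
qed

text \<open>A Schur test for the indicator of \<open>W\<close> as an integral kernel: the bound \<open>A\<close> on the sections over
  \<open>x\<close> enters with the power \<open>q - 1\<close> of the Hoelder inequality, and the bound \<open>B\<close> on the sections
  over \<open>z\<close> enters once, when the integrals are exchanged. Only points with \<open>f z \<noteq> 0\<close> count, which
  is how the disc comes in.\<close>

lemma (in pair_sigma_finite) nn_integral_powr_le_Lp:
  fixes f :: "'b \<Rightarrow> real" and G :: "'a \<Rightarrow> real" and W :: "('a \<times> 'b) set"
  assumes [measurable]: "f \<in> borel_measurable M2" "W \<in> sets (M1 \<Otimes>\<^sub>M M2)"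
    and q: "1 \<le> q"
    and G: "\<And>x. x \<in> space M1 \<Longrightarrow> ennreal \<bar>G x\<bar> \<le> (\<integral>\<^sup>+ z. ennreal \<bar>f z\<bar> * indicator W (x, z) \<partial>M2)"
    and A: "0 < A" "\<And>x. x \<in> space M1 \<Longrightarrow> emeasure M2 {z \<in> space M2. f z \<noteq> 0 \<and> (x, z) \<in> W} \<le> ennreal A"
    and B: "\<And>z. z \<in> space M2 \<Longrightarrow> f z \<noteq> 0 \<Longrightarrow> emeasure M1 {x \<in> space M1. (x, z) \<in> W} \<le> B"
  shows "(\<integral>\<^sup>+ x. ennreal (\<bar>G x\<bar> powr q) \<partial>M1)
    \<le> ennreal (A powr (q - 1)) * (B * (\<integral>\<^sup>+ z. ennreal (\<bar>f z\<bar> powr q) \<partial>M2))"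
proof -
  have "(\<integral>\<^sup>+ x. ennreal (\<bar>G x\<bar> powr q) \<partial>M1)
      \<le> (\<integral>\<^sup>+ x. ennreal (A powr (q - 1)) * (\<integral>\<^sup>+ z. ennreal (\<bar>f z\<bar> powr q) * indicator W (x, z) \<partial>M2) \<partial>M1)"
  proof (intro nn_integral_mono)
    fix x assume x: "x \<in> space M1"
    let ?W = "{z \<in> space M2. f z \<noteq> 0 \<and> (x, z) \<in> W}"
    have W: "?W \<in> sets M2"
      using x by measurable
    have eq: "(\<integral>\<^sup>+ z. ennreal \<bar>f z\<bar> * indicator W (x, z) \<partial>M2) = (\<integral>\<^sup>+ z. ennreal \<bar>f z\<bar> * indicator ?W z \<partial>M2)"
      "(\<integral>\<^sup>+ z. ennreal (\<bar>f z\<bar> powr q) * indicator W (x, z) \<partial>M2) = (\<integral>\<^sup>+ z. ennreal (\<bar>f z\<bar> powr q) * indicator ?W z \<partial>M2)"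
      by (auto intro!: nn_integral_cong split: split_indicator)
    show "ennreal (\<bar>G x\<bar> powr q)
        \<le> ennreal (A powr (q - 1)) * (\<integral>\<^sup>+ z. ennreal (\<bar>f z\<bar> powr q) * indicator W (x, z) \<partial>M2)"
      unfolding eq(2) using W q A(1) A(2)[OF x] G[OF x]
      by (intro powr_nn_integral_le) (simp_all add: eq(1))
  qed
  also have "\<dots> = ennreal (A powr (q - 1))
      * (\<integral>\<^sup>+ x. \<integral>\<^sup>+ z. ennreal (\<bar>f z\<bar> powr q) * indicator W (x, z) \<partial>M2 \<partial>M1)"
    by (rule nn_integral_cmult) measurable
  also have "\<dots> \<le> ennreal (A powr (q - 1)) * (B * (\<integral>\<^sup>+ z. ennreal (\<bar>f z\<bar> powr q) \<partial>M2))"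
    by (intro mult_left_mono nn_integral_sections_le B) auto
  finally show ?thesis .
qed

text \<open>The trivial bound \<open>\<bar>G x\<bar> \<le> L\<close> disposes of \<open>q - 1\<close> of the \<open>q\<close> factors of \<open>\<bar>G x\<bar> powr q\<close>;
  the integral of the remaining factor is at most \<open>L * B\<close>.\<close>

lemma (in pair_sigma_finite) nn_integral_powr_le_L1:
  fixes f :: "'b \<Rightarrow> real" and G :: "'a \<Rightarrow> real" and W :: "('a \<times> 'b) set"
  assumes [measurable]: "f \<in> borel_measurable M2" "W \<in> sets (M1 \<Otimes>\<^sub>M M2)"
    and q: "1 \<le> q"
    and G: "\<And>x. x \<in> space M1 \<Longrightarrow> ennreal \<bar>G x\<bar> \<le> (\<integral>\<^sup>+ z. ennreal \<bar>f z\<bar> * indicator W (x, z) \<partial>M2)"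
    and L: "0 \<le> L" "(\<integral>\<^sup>+ z. ennreal \<bar>f z\<bar> \<partial>M2) = ennreal L"
    and B: "\<And>z. z \<in> space M2 \<Longrightarrow> f z \<noteq> 0 \<Longrightarrow> emeasure M1 {x \<in> space M1. (x, z) \<in> W} \<le> B"
  shows "(\<integral>\<^sup>+ x. ennreal (\<bar>G x\<bar> powr q) \<partial>M1) \<le> ennreal (L powr q) * B"
proof -
  have GL: "\<bar>G x\<bar> \<le> L" if "x \<in> space M1" for x
  proof -
    have "ennreal \<bar>G x\<bar> \<le> (\<integral>\<^sup>+ z. ennreal \<bar>f z\<bar> \<partial>M2)"
      using G[OF that] by (rule order_trans) (auto intro!: nn_integral_mono split: split_indicator)
    then show ?thesis using L by simp
  qed
  have "(\<integral>\<^sup>+ x. ennreal (\<bar>G x\<bar> powr q) \<partial>M1)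
      \<le> (\<integral>\<^sup>+ x. ennreal (L powr (q - 1)) * (\<integral>\<^sup>+ z. ennreal \<bar>f z\<bar> * indicator W (x, z) \<partial>M2) \<partial>M1)"
  proof (intro nn_integral_mono)
    fix x assume x: "x \<in> space M1"
    have "\<bar>G x\<bar> powr q = \<bar>G x\<bar> powr (q - 1) * \<bar>G x\<bar>"
      using powr_mult_base[of "\<bar>G x\<bar>" "q - 1"] by (simp add: mult.commute)
    also have "\<dots> \<le> L powr (q - 1) * \<bar>G x\<bar>"
      using GL[OF x] q by (intro mult_right_mono powr_mono2) auto
    finally have "ennreal (\<bar>G x\<bar> powr q) \<le> ennreal (L powr (q - 1)) * ennreal \<bar>G x\<bar>"
      by (simp add: ennreal_leI flip: ennreal_mult)
    also have "\<dots> \<le> ennreal (L powr (q - 1)) * (\<integral>\<^sup>+ z. ennreal \<bar>f z\<bar> * indicator W (x, z) \<partial>M2)"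
      by (intro mult_left_mono G x) simp
    finally show "ennreal (\<bar>G x\<bar> powr q) \<le> \<dots>" .
  qed
  also have "\<dots> = ennreal (L powr (q - 1)) * (\<integral>\<^sup>+ x. \<integral>\<^sup>+ z. ennreal \<bar>f z\<bar> * indicator W (x, z) \<partial>M2 \<partial>M1)"
    by (rule nn_integral_cmult) measurable
  also have "\<dots> \<le> ennreal (L powr (q - 1)) * (B * (\<integral>\<^sup>+ z. ennreal \<bar>f z\<bar> \<partial>M2))"
    by (intro mult_left_mono nn_integral_sections_le B) auto
  also have "\<dots> = ennreal (L powr q) * B"
    using L powr_mult_base[of L "q - 1"] by (simp add: mult_ac flip: ennreal_mult)
  finally show ?thesis .
qed

section \<open>Norms\<close>

lemma ennreal_exponent_cases:
  fixes p :: ennreal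
  assumes "1 \<le> p"
  obtains "p = \<infinity>" | q where "1 \<le> q" "p = ennreal q"
proof (cases p)
  case (real q)
  then have "1 \<le> q" using assms by simp
  then show ?thesis using real that(2) by blast
qed (use that(1) in \<open>simp add: infinity_ennreal_def\<close>)

lemma Lp_norm_ennreal:
  assumes "1 \<le> q"
  shows "Lp_norm M (ennreal q) f =
    (if (\<integral>\<^sup>+ x. ennreal (\<bar>f x\<bar> powr q) \<partial>M) = \<infinity> then \<infinity>
     else ennreal (enn2real (\<integral>\<^sup>+ x. ennreal (\<bar>f x\<bar> powr q) \<partial>M) powr (1 / q)))"
  using assms by (simp add: Lp_norm_def Let_def recip_exponent_ennreal)

lemma Lp_norm_le:
  assumes q: "1 \<le> q" and c: "0 \<le> c"
    and le: "(\<integral>\<^sup>+ x. ennreal (\<bar>f x\<bar> powr q) \<partial>M) \<le> ennreal (c powr q)"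
  shows "Lp_norm M (ennreal q) f \<le> ennreal c"
proof -
  let ?I = "\<integral>\<^sup>+ x. ennreal (\<bar>f x\<bar> powr q) \<partial>M"
  have "?I < \<infinity>" using le by (rule order.strict_trans1) simp
  moreover have "enn2real ?I powr (1 / q) \<le> (c powr q) powr (1 / q)"
    using q le by (intro powr_mono2 enn2real_leI) auto
  ultimately show ?thesis
    using q c by (auto simp: Lp_norm_ennreal powr_powr)
qed

lemma Lp_norm_1: "Lp_norm M 1 f = (\<integral>\<^sup>+ x. ennreal \<bar>f x\<bar> \<partial>M)"
  using Lp_norm_ennreal[of 1 M f] by (auto simp: less_top)

lemma Lp_norm_zero: "1 \<le> p \<Longrightarrow> Lp_norm M p (\<lambda>x. 0) = 0"
proof (erule ennreal_exponent_cases)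
  assume "p = \<infinity>"
  have "esssup M (\<lambda>x. 0 :: ennreal) \<le> 0"
    by (rule esssup_I) auto
  then show ?thesis by (simp add: Lp_norm_def \<open>p = \<infinity>\<close>)
next
  fix q :: real assume "1 \<le> q" "p = ennreal q"
  then show ?thesis by (simp add: Lp_norm_ennreal)
qed

text \<open>For finite \<open>p\<close> this rests on \<open>\<bar>t\<bar> \<le> \<bar>t\<bar> powr q + 1\<close>, integrated over the support.\<close>

lemma integrable_bounded_support:
  fixes f :: "'a \<Rightarrow> real"
  assumes [measurable]: "f \<in> borel_measurable M" "W \<in> sets M"
    and W: "emeasure M W < \<infinity>" and supp: "\<And>z. z \<notin> W \<Longrightarrow> f z = 0"
    and p: "1 \<le> p" "Lp_norm M p f < \<infinity>"
  shows "integrable M f"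
  using p(1)
proof (cases rule: ennreal_exponent_cases)
  case 1
  then obtain s where s: "esssup M (\<lambda>z. ennreal \<bar>f z\<bar>) = ennreal s" "0 \<le> s"
    using p(2) by (cases "esssup M (\<lambda>z. ennreal \<bar>f z\<bar>)") (auto simp: Lp_norm_def)
  have "AE z in M. ennreal \<bar>f z\<bar> \<le> ennreal s"
    using esssup_AE[of "\<lambda>z. ennreal \<bar>f z\<bar>" M] by (simp add: s)
  then have "AE z in M. z \<in> W \<longrightarrow> norm (f z) \<le> s"
    by eventually_elim (use s in auto)
  then show ?thesis
    by (intro integrableI_bounded_set[of W]) (use W supp in auto)
next
  case (2 q)
  have "(\<integral>\<^sup>+ z. ennreal \<bar>f z\<bar> \<partial>M) \<le> (\<integral>\<^sup>+ z. ennreal (\<bar>f z\<bar> powr q) + indicator W z \<partial>M)"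
  proof (rule nn_integral_mono)
    fix z
    have "\<bar>f z\<bar> \<le> \<bar>f z\<bar> powr q + 1"
    proof (cases "\<bar>f z\<bar> \<le> 1")
      case False
      then have "\<bar>f z\<bar> powr 1 \<le> \<bar>f z\<bar> powr q" using 2 by (intro powr_mono) auto
      then show ?thesis using False by simp
    qed (simp add: add_increasing)
    then have "ennreal \<bar>f z\<bar> \<le> ennreal (\<bar>f z\<bar> powr q) + 1"
      by (simp add: ennreal_leI flip: ennreal_plus ennreal_1)
    then show "ennreal \<bar>f z\<bar> \<le> ennreal (\<bar>f z\<bar> powr q) + indicator W z"
      using supp[of z] by (cases "z \<in> W") auto
  qed
  also have "\<dots> = (\<integral>\<^sup>+ z. ennreal (\<bar>f z\<bar> powr q) \<partial>M) + emeasure M W"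
    by (subst nn_integral_add) auto
  also have "\<dots> < \<infinity>"
    using W p 2 by (auto simp: Lp_norm_ennreal less_top split: if_splits)
  finally show ?thesis
    by (intro integrableI_bounded) auto
qed

text \<open>Allows a Lebesgue measurable function to be replaced by a Borel representative. The essential
  supremum needs the measurability of both functions, because it is defined as \<open>\<infinity>\<close> for a
  non-measurable function.\<close>

lemma Lp_norm_completion_cong_AE:
  assumes m: "f \<in> borel_measurable M" "F \<in> borel_measurable (completion M)"
    and ae: "AE z in M. F z = f z"
  shows "Lp_norm (completion M) p F = Lp_norm M p f"
proof (cases "p = \<infinity>")
  case True
  have "esssup (completion M) (\<lambda>z. ennreal \<bar>F z\<bar>) = Inf {c. AE z in completion M. ennreal \<bar>F z\<bar> \<le> c}"
    using m by (intro esssup_eq_AE) measurable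
  also have "\<dots> = Inf {c. AE z in M. ennreal \<bar>f z\<bar> \<le> c}"
  proof (intro arg_cong[where f = Inf] Collect_cong)
    fix c
    have "(AE z in M. ennreal \<bar>F z\<bar> \<le> c) \<longleftrightarrow> (AE z in M. ennreal \<bar>f z\<bar> \<le> c)"
      by (rule eventually_subst) (use ae in \<open>eventually_elim, simp\<close>)
    then show "(AE z in completion M. ennreal \<bar>F z\<bar> \<le> c) \<longleftrightarrow> (AE z in M. ennreal \<bar>f z\<bar> \<le> c)"
      by (simp add: AE_completion_iff)
  qed
  also have "\<dots> = esssup M (\<lambda>z. ennreal \<bar>f z\<bar>)"
    using m by (intro esssup_eq_AE[symmetric]) measurable
  finally show ?thesis
    by (simp add: Lp_norm_def True)
next
  case False
  have "(\<integral>\<^sup>+ z. ennreal (\<bar>F z\<bar> powr r) \<partial>completion M) = (\<integral>\<^sup>+ z. ennreal (\<bar>f z\<bar> powr r) \<partial>M)" for r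
    unfolding nn_integral_completion by (rule nn_integral_cong_AE) (use ae in \<open>eventually_elim, simp\<close>)
  then show ?thesis
    using False by (simp add: Lp_norm_def)
qed

section \<open>The difference of two half-plane integrals\<close>

text \<open>By \<open>volterra_projection_diff\<close> this is the Volterra transform of the difference of two projections
  of \<open>f\<close>. For integrable \<open>f\<close> the integral converges absolutely at every \<open>x\<close>, unlike those that
  define the projections.\<close>

definition halfplane_integral_diff :: "(real \<times> real \<Rightarrow> real) \<Rightarrow> real \<Rightarrow> real \<Rightarrow> real \<Rightarrow> real" where
  "halfplane_integral_diff f \<theta> \<phi> x
    = (\<integral>z. (indicator {z. coord \<theta> z \<le> x} z - indicator {z. coord \<phi> z \<le> x} z) * f z \<partial>lborel)"

lemma halfplane_diff_graph_measurable [measurable]: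
  "{w. snd w \<in> halfplane_diff \<theta> \<phi> (fst w)} \<in> sets (borel \<Otimes>\<^sub>M borel)"
proof -
  have "Measurable.pred (borel \<Otimes>\<^sub>M borel) (\<lambda>w. (coord \<theta> (snd w) \<le> fst w) \<noteq> (coord \<phi> (snd w) \<le> fst w))"
    by measurable
  then show ?thesis
    by (simp add: pred_def halfplane_diff_def space_pair_measure)
qed

lemma halfplane_integral_diff_measurable [measurable]:
  assumes [measurable]: "f \<in> borel_measurable borel"
  shows "halfplane_integral_diff f \<theta> \<phi> \<in> borel_measurable borel"
proof -
  have "(\<lambda>x. \<integral>z. (indicator {z. coord \<theta> z \<le> x} z - indicator {z. coord \<phi> z \<le> x} z) * f z \<partial>lborel)
      \<in> borel_measurable lborel"
    unfolding indicator_def by (rule lborel.borel_measurable_lebesgue_integral) simp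
  moreover have "halfplane_integral_diff f \<theta> \<phi>
      = (\<lambda>x. \<integral>z. (indicator {z. coord \<theta> z \<le> x} z - indicator {z. coord \<phi> z \<le> x} z) * f z \<partial>lborel)"
    by (rule ext) (simp add: halfplane_integral_diff_def)
  ultimately show ?thesis by simp
qed

text \<open>The two Schur-type estimates for the kernel \<open>z \<in> halfplane_diff \<theta> \<phi> x\<close>, with \<open>A = d R\<^sup>2\<close> and
  \<open>B = 2 sin (d / 2) R\<close>.\<close>

lemma halfplane_integral_diff_powr_le:
  assumes f: "integrable lborel f" and supp: "\<And>z. norm z > R \<Longrightarrow> f z = 0"
    and R: "0 < R" and d: "d = \<bar>\<theta> - \<phi>\<bar>" "0 < d" "d < pi" and q: "1 \<le> q"
  shows "(\<integral>\<^sup>+ x. ennreal (\<bar>halfplane_integral_diff f \<theta> \<phi> x\<bar> powr q) \<partial>lborel)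
      \<le> ennreal ((d * R\<^sup>2) powr (q - 1)) * (ennreal (2 * sin (d / 2) * R) * (\<integral>\<^sup>+ z. ennreal (\<bar>f z\<bar> powr q) \<partial>lborel))"
    and "(\<integral>\<^sup>+ x. ennreal (\<bar>halfplane_integral_diff f \<theta> \<phi> x\<bar> powr q) \<partial>lborel)
      \<le> ennreal ((\<integral>z. \<bar>f z\<bar> \<partial>lborel) powr q) * ennreal (2 * sin (d / 2) * R)"
proof -
  let ?W = "{w. snd w \<in> halfplane_diff \<theta> \<phi> (fst w)}"
  have mf: "f \<in> borel_measurable lborel"
    using f by simp
  have mW: "?W \<in> sets (lborel \<Otimes>\<^sub>M lborel)"
    using halfplane_diff_graph_measurable[of \<theta> \<phi>]
    by (simp cong: sets_pair_measure_cong add: sets_lborel)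
  have G: "ennreal \<bar>halfplane_integral_diff f \<theta> \<phi> x\<bar>
      \<le> (\<integral>\<^sup>+ z. ennreal \<bar>f z\<bar> * indicator ?W (x, z) \<partial>lborel)" for x
    using abs_integral_halfplane_diff_le[OF f, of \<theta> x \<phi>]
    by (simp add: halfplane_integral_diff_def indicator_def)
  have nz: "norm z \<le> R" if "f z \<noteq> 0" for z
    using supp[of z] that by (meson not_le)
  have B: "emeasure lborel {x \<in> space lborel. (x, z) \<in> ?W} \<le> ennreal (2 * sin (d / 2) * R)" if "f z \<noteq> 0" for z
    using emeasure_halfplane_diff_offsets_le[of \<theta> \<phi> z R] nz[OF that] d by simp
  have A: "emeasure lborel {z \<in> space lborel. f z \<noteq> 0 \<and> (x, z) \<in> ?W} \<le> ennreal (d * R\<^sup>2)" for x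
  proof -
    have "emeasure lborel {z \<in> space lborel. f z \<noteq> 0 \<and> (x, z) \<in> ?W}
        \<le> emeasure lborel (halfplane_diff \<theta> \<phi> x \<inter> cball 0 R)"
      using nz by (intro emeasure_mono) auto
    also have "\<dots> \<le> ennreal (d * R\<^sup>2)"
      using emeasure_halfplane_diff_le[of \<theta> \<phi> R x] R d by simp
    finally show ?thesis .
  qed
  show "(\<integral>\<^sup>+ x. ennreal (\<bar>halfplane_integral_diff f \<theta> \<phi> x\<bar> powr q) \<partial>lborel)
      \<le> ennreal ((d * R\<^sup>2) powr (q - 1)) * (ennreal (2 * sin (d / 2) * R) * (\<integral>\<^sup>+ z. ennreal (\<bar>f z\<bar> powr q) \<partial>lborel))"
    using d R by (intro lborel_pair.nn_integral_powr_le_Lp[OF mf mW q G _ A B]) simp_all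
  show "(\<integral>\<^sup>+ x. ennreal (\<bar>halfplane_integral_diff f \<theta> \<phi> x\<bar> powr q) \<partial>lborel)
      \<le> ennreal ((\<integral>z. \<bar>f z\<bar> \<partial>lborel) powr q) * ennreal (2 * sin (d / 2) * R)"
    using f by (intro lborel_pair.nn_integral_powr_le_L1[OF mf mW q G _ _ B])
      (simp_all add: nn_integral_eq_integral)
qed

lemma halfplane_integral_diff_sup_le:
  assumes f: "integrable lborel f" and supp: "\<And>z. norm z > R \<Longrightarrow> f z = 0"
    and R: "0 < R" and d: "d = \<bar>\<theta> - \<phi>\<bar>" "d < pi"
    and N: "AE z in lborel. ennreal \<bar>f z\<bar> \<le> N"
  shows "ennreal \<bar>halfplane_integral_diff f \<theta> \<phi> x\<bar> \<le> N * ennreal (d * R\<^sup>2)"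
proof -
  let ?D = "halfplane_diff \<theta> \<phi> x"
  have "ennreal \<bar>halfplane_integral_diff f \<theta> \<phi> x\<bar> \<le> (\<integral>\<^sup>+z. ennreal \<bar>f z\<bar> * indicator ?D z \<partial>lborel)"
    unfolding halfplane_integral_diff_def by (rule abs_integral_halfplane_diff_le[OF f])
  also have "\<dots> \<le> (\<integral>\<^sup>+z. N * indicator (?D \<inter> cball 0 R) z \<partial>lborel)"
  proof (rule nn_integral_mono_AE, use N in eventually_elim)
    fix z assume "ennreal \<bar>f z\<bar> \<le> N"
    then show "ennreal \<bar>f z\<bar> * indicator ?D z \<le> N * indicator (?D \<inter> cball 0 R) z"
      using supp[of z] by (cases "norm z \<le> R") (auto split: split_indicator)
  qed
  also have "\<dots> = N * emeasure lborel (?D \<inter> cball 0 R)"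
    by (simp add: nn_integral_cmult_indicator)
  also have "\<dots> \<le> N * ennreal (d * R\<^sup>2)"
    using emeasure_halfplane_diff_le[of \<theta> \<phi> R x] R d by (intro mult_left_mono) simp_all
  finally show ?thesis .
qed

lemma Lp_norm_halfplane_integral_diff_le:
  assumes f: "integrable lborel f" and supp: "\<And>z. norm z > R \<Longrightarrow> f z = 0"
    and R: "0 < R" and d: "d = \<bar>\<theta> - \<phi>\<bar>" "0 < d" "d < pi"
    and p: "1 \<le> p" and fin: "Lp_norm lborel p f < \<infinity>"
  shows "Lp_norm (lebesgue_on {a..b}) p (halfplane_integral_diff f \<theta> \<phi>)
    \<le> ennreal ((2 * sin (d / 2)) powr recip_exponent p) *
      min (ennreal (d powr (1 - recip_exponent p)) * Lp_norm lborel p f *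
             ennreal (R powr (2 - recip_exponent p)))
          (Lp_norm lborel 1 f * ennreal (R powr recip_exponent p))"
proof -
  let ?G = "halfplane_integral_diff f \<theta> \<phi>"
  define S where "S = 2 * sin (d / 2)"
  have S: "S > 0"
    unfolding S_def using d by (intro mult_pos_pos sin_gt_zero) auto
  have [measurable]: "f \<in> borel_measurable borel"
    using borel_measurable_integrable[OF f] by simp
  define L where "L = (\<integral>z. \<bar>f z\<bar> \<partial>lborel)"
  have L0: "0 \<le> L" by (simp add: L_def)
  have L: "Lp_norm lborel 1 f = ennreal L"
    using f by (simp add: Lp_norm_1 L_def nn_integral_eq_integral)
  show ?thesis
    using p
  proof (cases rule: ennreal_exponent_cases)
    case 1
    define N where "N = Lp_norm lborel p f"
    have N: "AE z in lborel. ennreal \<bar>f z\<bar> \<le> N"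
      using esssup_AE[of "\<lambda>z. ennreal \<bar>f z\<bar>" lborel] by (simp add: N_def Lp_norm_def 1)
    have GL: "ennreal \<bar>?G x\<bar> \<le> ennreal L" for x
    proof -
      have "ennreal \<bar>?G x\<bar> \<le> (\<integral>\<^sup>+z. ennreal \<bar>f z\<bar> * indicator (halfplane_diff \<theta> \<phi> x) z \<partial>lborel)"
        unfolding halfplane_integral_diff_def by (rule abs_integral_halfplane_diff_le[OF f])
      also have "\<dots> \<le> (\<integral>\<^sup>+z. ennreal \<bar>f z\<bar> \<partial>lborel)"
        by (intro nn_integral_mono) (auto split: split_indicator)
      finally show ?thesis using L by (simp add: Lp_norm_1)
    qed
    have "?G \<in> borel_measurable (lebesgue_on {a..b})"
      by (intro measurable_restrict_space1 measurable_completion) simp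
    then have "(\<lambda>x. ennreal \<bar>?G x\<bar>) \<in> borel_measurable (lebesgue_on {a..b})"
      by measurable
    then have "esssup (lebesgue_on {a..b}) (\<lambda>x. ennreal \<bar>?G x\<bar>) \<le> min (N * ennreal (d * R\<^sup>2)) (ennreal L)"
      by (rule esssup_I) (use GL halfplane_integral_diff_sup_le[OF f supp R d(1,3) N] in auto)
    also have "N * ennreal (d * R\<^sup>2) = ennreal d * N * ennreal (R\<^sup>2)"
      using d by (simp add: ennreal_mult mult_ac)
    finally have "Lp_norm (lebesgue_on {a..b}) p ?G \<le> min (ennreal d * N * ennreal (R\<^sup>2)) (ennreal L)"
      by (simp add: 1 Lp_norm_def)
    also have "\<dots> = ennreal (S powr recip_exponent p) *
        min (ennreal (d powr (1 - recip_exponent p)) * N * ennreal (R powr (2 - recip_exponent p)))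
          (ennreal L * ennreal (R powr recip_exponent p))"
      using S d(2) R by (simp add: 1 recip_exponent_def)
    finally show ?thesis
      by (simp only: L N_def S_def)
  next
    case (2 q)
    have q: "1 \<le> q" "q > 0" using 2 by simp_all
    obtain j where j: "(\<integral>\<^sup>+ z. ennreal (\<bar>f z\<bar> powr q) \<partial>lborel) = ennreal j" "0 \<le> j"
      using fin 2 by (cases "\<integral>\<^sup>+ z. ennreal (\<bar>f z\<bar> powr q) \<partial>lborel") (auto simp: Lp_norm_ennreal)
    have n: "Lp_norm lborel p f = ennreal (j powr (1 / q))"
      using q j by (simp add: 2 Lp_norm_ennreal)
    have restrict: "(\<integral>\<^sup>+ x. ennreal (\<bar>?G x\<bar> powr q) \<partial>lebesgue_on {a..b})
        \<le> (\<integral>\<^sup>+ x. ennreal (\<bar>?G x\<bar> powr q) \<partial>lborel)"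
      by (subst nn_integral_restrict_space, simp, subst nn_integral_completion)
         (auto intro!: nn_integral_mono split: split_indicator)
    \<comment> \<open>The two terms of the claimed minimum; their \<open>q\<close>-th powers are the two Schur-type bounds.\<close>
    define c1 where "c1 = S powr (1 / q) * (d powr (1 - 1 / q) * j powr (1 / q) * R powr (2 - 1 / q))"
    define c2 where "c2 = S powr (1 / q) * (L * R powr (1 / q))"
    have c1: "c1 powr q = (d * R\<^sup>2) powr (q - 1) * (S * R * j)"
    proof -
      have "c1 powr q = S * (d powr (q - 1) * j * R powr (2 * q - 1))"
        using q S d R j by (simp add: c1_def powr_mult powr_powr left_diff_distrib)
      also have "2 * q - 1 = 2 * (q - 1) + 1" by simp
      also have "R powr (2 * (q - 1) + 1) = (R powr 2) powr (q - 1) * R powr 1"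
        by (simp only: powr_add powr_powr)
      finally show ?thesis
        using d(2) R by (simp add: powr_mult mult_ac)
    qed
    have c2: "c2 powr q = L powr q * (S * R)"
      using q S R L0 by (simp add: c2_def powr_mult powr_powr)
    have "Lp_norm (lebesgue_on {a..b}) p ?G \<le> ennreal c1"
      unfolding 2
    proof (rule Lp_norm_le[OF q(1)])
      show "0 \<le> c1" by (simp add: c1_def)
      show "(\<integral>\<^sup>+ x. ennreal (\<bar>?G x\<bar> powr q) \<partial>lebesgue_on {a..b}) \<le> ennreal (c1 powr q)"
        using order_trans[OF restrict halfplane_integral_diff_powr_le(1)[OF f supp R d q(1)]] S R j
        by (simp add: c1 S_def[symmetric] ennreal_mult)
    qed
    moreover have "Lp_norm (lebesgue_on {a..b}) p ?G \<le> ennreal c2"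
      unfolding 2
    proof (rule Lp_norm_le[OF q(1)])
      show "0 \<le> c2" using L0 by (simp add: c2_def)
      show "(\<integral>\<^sup>+ x. ennreal (\<bar>?G x\<bar> powr q) \<partial>lebesgue_on {a..b}) \<le> ennreal (c2 powr q)"
        using order_trans[OF restrict halfplane_integral_diff_powr_le(2)[OF f supp R d q(1)]] S R L0
        by (simp add: c2 S_def[symmetric] L_def[symmetric] ennreal_mult)
    qed
    moreover have min_mult: "min (k * x) (k * y) = k * min x y" for k x y :: ennreal
      using min_of_mono[of "(*) k" x y] by (simp add: monoI mult_left_mono)
    ultimately have "Lp_norm (lebesgue_on {a..b}) p ?G \<le> min (ennreal c1) (ennreal c2)"
      by simp
    also have "\<dots> = ennreal (S powr (1 / q)) *
        min (ennreal (d powr (1 - 1 / q)) * ennreal (j powr (1 / q)) * ennreal (R powr (2 - 1 / q)))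
            (ennreal L * ennreal (R powr (1 / q)))"
      using L0 by (simp add: c1_def c2_def ennreal_mult mult.assoc flip: min_mult)
    finally show ?thesis
      using q by (simp only: n L S_def[symmetric]) (simp add: 2 recip_exponent_ennreal)
  qed
qed

section \<open>The estimate\<close>

theorem theorem4p2:
  fixes p :: ennreal and R \<theta> \<phi> \<delta> :: real and F :: "real \<times> real \<Rightarrow> real"
  assumes "1 \<le> p" and "R > 0"
    and "F \<in> Lp_space lebesgue p"
    and "AE z in lebesgue. z \<notin> cball (0, 0) R \<longrightarrow> F z = 0"
    and "\<delta> = \<bar>\<theta> - \<phi>\<bar>" and "\<delta> < pi"
  shows "volterra_norm p (- R) R (\<lambda>x. projection F \<theta> x - projection F \<phi> x)
    \<le> ennreal ((2 * sin (\<delta> / 2)) powr recip_exponent p) *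
      min (ennreal (\<delta> powr (1 - recip_exponent p)) * Lp_norm lebesgue p F *
             ennreal (R powr (2 - recip_exponent p)))
          (Lp_norm lebesgue 1 F * ennreal (R powr recip_exponent p))"
proof (cases "\<delta> = 0")
  case True
  \<comment> \<open>Equal angles are treated apart: the area bound \<open>\<delta> R\<^sup>2\<close> has to be positive to serve as a
    divisor in the Hoelder inequality, and for \<open>p = \<infinity>\<close> the factor \<open>(2 sin (\<delta> / 2)) powr 0\<close> is
    \<open>1\<close> only if \<open>\<delta> \<noteq> 0\<close>.\<close>
  then have "volterra (- R) (\<lambda>x. projection F \<theta> x - projection F \<phi> x) = (\<lambda>x. 0)"
    using assms(5) by (auto simp: volterra_def)
  then show ?thesis
    using assms(1) by (simp add: volterra_norm_def Lp_norm_zero)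
next
  case False
  then have \<delta>: "0 < \<delta>" using assms(5) by simp
  have F: "F \<in> borel_measurable lebesgue" "Lp_norm lebesgue p F < \<infinity>"
    using assms(3) by (auto simp: Lp_space_def)
  \<comment> \<open>A Borel representative \<open>f\<close> of \<open>F\<close> that vanishes everywhere outside the disc.\<close>
  obtain f0 where f0 [measurable]: "f0 \<in> borel_measurable lborel" and ae0: "AE z in lborel. F z = f0 z"
    using completion_ex_borel_measurable_real[OF F(1)] by blast
  define f where "f z = indicator (cball 0 R) z * f0 z" for z
  have "indicat_real (cball (0 :: real \<times> real) R) \<in> borel_measurable borel"
    by (intro borel_measurable_indicator borel_closed closed_cball)
  then have mf: "f \<in> borel_measurable lborel"
    unfolding f_def by (intro borel_measurable_times f0) simp
  have supp: "norm z > R \<Longrightarrow> f z = 0" for z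
    by (simp add: f_def)
  have "AE z in lborel. z \<notin> cball (0, 0) R \<longrightarrow> F z = 0"
    using assms(4) by (simp only: AE_completion_iff)
  then have ae: "AE z in lborel. F z = f z"
    using ae0 by eventually_elim (auto simp: f_def indicator_def zero_prod_def)
  have norms: "Lp_norm lebesgue r F = Lp_norm lborel r f" for r
    by (rule Lp_norm_completion_cong_AE[OF mf F(1) ae])
  have f: "integrable lborel f"
    using F(2) assms(1) mf supp emeasure_lborel_cball_finite
    by (intro integrable_bounded_support[of f lborel "cball 0 R" p]) (auto simp: norms)
  have "volterra (- R) (\<lambda>x. projection F \<theta> x - projection F \<phi> x) = halfplane_integral_diff f \<theta> \<phi>"
    by (rule ext) (simp add: halfplane_integral_diff_def volterra_projection_diff[OF f supp ae])
  then show ?thesis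
    using Lp_norm_halfplane_integral_diff_le[OF f supp assms(2,5) \<delta> assms(6) assms(1)] F(2)
    by (simp add: volterra_norm_def norms)
qed

end
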